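(* Let $0<\alpha\le 1$ and let $\{X_i\}_{1\le i\le n}$ be a sequence of independent random variables with distribution $\bar{F}_{X_i}(t)=E_{\alpha}(-\lambda_i t^{\alpha})$, where $\lambda_i>0$, $1\le i\le n$. Then the pdf and cdf of $X=X_1+X_2+\dots+X_n$ are given by $$f_X(t)=t^{\alpha-1}\sum_{i=1}^{n}\lambda_i E_{\alpha,\alpha}(-\lambda_i t^{\alpha})\prod_{\substack{k=1\\k\ne i}}^{n}\frac{\lambda_k}{\lambda_k-\lambda_i}$$ and $$F_X(t)=1-\sum_{i=1}^{n}E_{\alpha}(-\lambda_i t^{\alpha})\prod_{\substack{k=1\\k\ne i}}^{n}\frac{\lambda_k}{\lambda_k-\lambda_i},$$ respectively.
   Context: For a random variable $X$, $f_X(t)$, $F_X(t)$ and $\bar{F}_X(t)=1-F_X(t)=\mathrm{Pr}\{X>t\}$, $t\ge 0$, denote its probability density function (pdf), cumulative distribution function (cdf) and tail distribution function. For $\alpha,\beta>0$ the two-parameter Mittag-Leffler function is $E_{\alpha,\beta}(x)=\sum_{k=0}^{\infty}\frac{x^k}{\Gamma(\alpha k+\beta)}$, $x\in\mathbb{R}$, and $E_{\alpha}=E_{\alpha,1}$ is the one-parameter Mittag-Leffler function.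
   Formalization: The rates λ_1,…,λ_n are assumed pairwise distinct, since otherwise the factors λ_k/(λ_k−λ_i) are undefined; the pdf formula is taken for t>0 (with density 0 for t≤0) and the cdf formula for t≥0. *)

theory Defs
  imports "HOL-Probability.Probability"
begin

definition mittag_leffler2 :: "real \<Rightarrow> real \<Rightarrow> real \<Rightarrow> real" where
  "mittag_leffler2 \<alpha> \<beta> x = (\<Sum>k. x ^ k / Gamma (\<alpha> * real k + \<beta>))"

definition mittag_leffler :: "real \<Rightarrow> real \<Rightarrow> real" where
  "mittag_leffler \<alpha> x = mittag_leffler2 \<alpha> 1 x"

text \<open>
  The library's \<open>distributed\<close> takes an extended nonnegative density, and \<open>ennreal\<close> truncates
  negative reals to 0. Nonnegativity is therefore required separately, so that a real
  formula that takes negative values does not count as a pdf.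
\<close>

definition has_pdf :: "'a measure \<Rightarrow> ('a \<Rightarrow> real) \<Rightarrow> (real \<Rightarrow> real) \<Rightarrow> bool" where
  "has_pdf M X f \<longleftrightarrow>
     f \<in> borel_measurable borel \<and> (\<forall>t. 0 \<le> f t) \<and>
     distributed M lborel X (\<lambda>t. ennreal (f t))"

end

theory Submission
  imports Defs
begin

text \<open>
  Write \<open>g\<^sub>l(t) = l t\<^sup>\<alpha>\<^sup>-\<^sup>1 E\<^sub>\<alpha>\<^sub>,\<^sub>\<alpha>(-l t\<^sup>\<alpha>)\<close> on the positive half-line. Differentiating the
  Mittag-Leffler series term by term shows that \<open>-g\<^sub>l\<close> is the derivative of the tail
  \<open>E\<^sub>\<alpha>(-l t\<^sup>\<alpha>)\<close>, so a variable with this tail has density \<open>g\<^sub>l\<close>; a tail is decreasing, and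
  therefore \<open>g\<^sub>l\<close> is nonnegative
  (\<open>distributed_mittag_leffler\<close>, \<open>mittag_leffler_density_nonneg\<close>).

  The heart of the matter is the convolution identity
  \<open>(m - l) (g\<^sub>l * g\<^sub>m) = m g\<^sub>l - l g\<^sub>m\<close> for \<open>l \<noteq> m\<close>
  (\<open>has_bochner_integral_mittag_leffler_convolution\<close>). The kernels
  \<open>p\<^sub>a(t) = t\<^sup>a\<^sup>-\<^sup>1 / \<Gamma>(a)\<close> form a convolution semigroup by the Beta integral, so \<open>p\<^sub>\<alpha>\<^sub>j\<close> is the
  \<open>j\<close>-th convolution power of \<open>p = p\<^sub>\<alpha>\<close>, and \<open>g\<^sub>l\<close> is the geometric series for \<open>l p / (1 + l p)\<close> in
  the convolution algebra. The identity is then nothing but the partial fraction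
  decomposition of \<open>l p / (1 + l p) \<cdot> m p / (1 + m p)\<close>. At the level of series it
  is the Cauchy product together with \<open>(x - y) (\<Sum>i\<le>k. x\<^sup>i y\<^sup>k\<^sup>-\<^sup>i) = x\<^sup>k\<^sup>+\<^sup>1 - y\<^sup>k\<^sup>+\<^sup>1\<close>; superexponential
  growth of \<open>\<Gamma>\<close> justifies the termwise integration.

  Hence the set of linear combinations of the \<open>g\<^sub>l\<close> is stable under convolution with a new
  \<open>g\<^sub>m\<close>, and an induction on the number of summands yields the density. The coefficients follow
  the recursion of the partial fraction coefficients of \<open>x \<mapsto> \<Prod>k. \<lambda>\<^sub>k / (\<lambda>\<^sub>k - x)\<close>:
  the coefficient of the newly added density is the value of the old partial fraction sum at
  the new rate (\<open>partial_fraction_decomposition\<close>). The value at \<open>x = 0\<close> says that the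
  coefficients sum to 1, which turns the integrated density into the distribution function.
\<close>

section \<open>Growth of the Gamma function and Mittag-Leffler series\<close>

text \<open>
  The Gamma function outgrows \<open>R\<^sup>x\<close> for every \<open>R\<close>, because the piece of Euler's integral over
  \<open>[R, R + 1]\<close> is already of that order. Comparing \<open>u\<^sup>x / u\<close> rather than \<open>u\<^sup>x\<^sup>-\<^sup>1\<close> gives a bound
  that is valid for all \<open>x > 0\<close>, also where \<open>u\<^sup>x\<^sup>-\<^sup>1\<close> decreases.
\<close>
lemma Gamma_real_ge_powr:
  fixes x R :: real
  assumes x: "x > 0" and R: "R > 0"
  shows "R powr x * (exp (- (R + 1)) / (R + 1)) \<le> Gamma x"
proof -
  have I: "((\<lambda>u. u powr (x - 1) / exp u) has_integral Gamma x) {0..}"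
    using Gamma_integral_real[OF x] .
  define c where "c = R powr x * (exp (- (R + 1)) / (R + 1))"
  have C: "((\<lambda>u. c) has_integral c) {R..R+1}"
    using has_integral_const_real[of c R "R + 1"] by simp
  have le: "R powr x * (exp (- (R + 1)) / (R + 1)) \<le> u powr (x - 1) / exp u"
    if u: "u \<in> {R..R+1}" for u
  proof -
    have "R powr x * (exp (- (R + 1)) / (R + 1)) \<le> u powr x * (exp (- u) / u)"
      using u R x by (intro mult_mono frac_le powr_mono2) auto
    also have "\<dots> = u powr (x - 1) / exp u"
      using u R by (simp add: powr_diff exp_minus field_simps)
    finally show ?thesis .
  qed
  have "((\<lambda>u. if u \<in> {R..R+1} then c else 0) has_integral c) {0..}"
    using C R by (subst has_integral_restrict) auto
  then have "c \<le> Gamma x"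
    by (rule has_integral_le[OF _ I]) (use le in \<open>auto simp: c_def\<close>)
  then show ?thesis by (simp add: c_def)
qed

lemma summable_norm_mittag_leffler2:
  fixes \<alpha> \<beta> z :: real
  assumes \<alpha>: "\<alpha> > 0" and \<beta>: "\<beta> > 0"
  shows "summable (\<lambda>k. norm (z ^ k / Gamma (\<alpha> * real k + \<beta>)))"
proof -
  \<comment> \<open>\<open>R\<close> is chosen with \<open>R\<^sup>\<alpha> = q\<close>, so that \<open>\<Gamma>(\<alpha> k + \<beta>)\<close> dominates \<open>q\<^sup>k\<close> and the ratio
      \<open>\<bar>z\<bar> / q\<close> is below one half.\<close>
  define q where "q = 2 * (\<bar>z\<bar> + 1)"
  define R where "R = q powr (1 / \<alpha>)"
  have q: "q > 0" by (auto simp: q_def)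
  have R: "R > 0" using q by (simp add: R_def)
  define C where "C = R powr \<beta> * (exp (- (R + 1)) / (R + 1))"
  have C: "C > 0" using R by (simp add: C_def)
  have Rk: "R powr (\<alpha> * real k) = q ^ k" for k
    using \<alpha> q by (simp add: R_def powr_powr powr_realpow)
  have bound: "norm (z ^ k / Gamma (\<alpha> * real k + \<beta>)) \<le> (1 / C) * (1 / 2) ^ k" for k
  proof -
    have "q ^ k * C \<le> Gamma (\<alpha> * real k + \<beta>)"
      using Gamma_real_ge_powr[of "\<alpha> * real k + \<beta>" R] \<alpha> \<beta> R
      by (simp add: powr_add Rk C_def add_nonneg_pos mult.assoc)
    moreover have "0 < Gamma (\<alpha> * real k + \<beta>)"
      using \<alpha> \<beta> by (intro Gamma_real_pos add_nonneg_pos) auto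
    ultimately have "norm (z ^ k / Gamma (\<alpha> * real k + \<beta>)) \<le> \<bar>z\<bar> ^ k / (q ^ k * C)"
      using q C by (simp add: power_abs frac_le)
    also have "\<dots> = (1 / C) * (\<bar>z\<bar> / q) ^ k"
      by (simp add: power_divide)
    also have "\<dots> \<le> (1 / C) * (1 / 2) ^ k"
      using C by (intro mult_left_mono power_mono) (simp_all add: q_def divide_simps)
    finally show ?thesis .
  qed
  have "summable (\<lambda>k. (1 / C) * (1 / 2 :: real) ^ k)"
    by (intro summable_mult summable_geometric) simp
  then show ?thesis
    by (rule summable_comparison_test'[where N = 0]) (unfold real_norm_def abs_idempotent, rule bound[unfolded real_norm_def])
qed

lemma mittag_leffler2_powser:
  "mittag_leffler2 \<alpha> \<beta> = (\<lambda>x. \<Sum>k. inverse (Gamma (\<alpha> * real k + \<beta>)) * x ^ k)"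
  by (simp add: fun_eq_iff mittag_leffler2_def field_simps)

lemma summable_mittag_leffler2_powser:
  fixes \<alpha> \<beta> z :: real
  assumes "\<alpha> > 0" and "\<beta> > 0"
  shows "summable (\<lambda>k. inverse (Gamma (\<alpha> * real k + \<beta>)) * z ^ k)"
  using summable_norm_cancel[OF summable_norm_mittag_leffler2[OF assms, of z]]
  by (simp add: field_simps)

lemma isCont_mittag_leffler2:
  assumes "\<alpha> > 0" and "\<beta> > 0"
  shows "isCont (mittag_leffler2 \<alpha> \<beta>) x"
  unfolding mittag_leffler2_powser
  by (rule isCont_powser_converges_everywhere[OF summable_mittag_leffler2_powser[OF assms]])

lemma mittag_leffler_0 [simp]: "mittag_leffler \<alpha> 0 = 1"
proof -
  have "mittag_leffler \<alpha> 0 = inverse (Gamma (\<alpha> * real 0 + 1))"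
    unfolding mittag_leffler_def mittag_leffler2_powser by (rule powser_zero)
  then show ?thesis by simp
qed

lemma isCont_mittag_leffler: "\<alpha> > 0 \<Longrightarrow> isCont (mittag_leffler \<alpha>) x"
  using isCont_mittag_leffler2[of \<alpha> 1 x] by (simp add: mittag_leffler_def[abs_def])

text \<open>
  Termwise differentiation: \<open>\<Gamma>(y + 1) = y \<Gamma>(y)\<close> at \<open>y = \<alpha> (k + 1)\<close> cancels the factor
  \<open>k + 1\<close> brought down from the exponent and leaves \<open>1 / \<alpha>\<close>.
\<close>
lemma DERIV_mittag_leffler:
  assumes \<alpha>: "\<alpha> > 0"
  shows "(mittag_leffler \<alpha> has_field_derivative mittag_leffler2 \<alpha> \<alpha> x / \<alpha>) (at x)"
proof -
  define c where "c = (\<lambda>k. inverse (Gamma (\<alpha> * real k + 1)))"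
  have d: "diffs c k = inverse (Gamma (\<alpha> * real k + \<alpha>)) / \<alpha>" for k
  proof -
    define y where "y = \<alpha> * real k + \<alpha>"
    have y: "y > 0" "y = \<alpha> * real (Suc k)"
      using \<alpha> by (simp_all add: y_def add_nonneg_pos distrib_left)
    have "Gamma (y + 1) = y * Gamma y"
      using y(1) by (subst Gamma_plus1) auto
    then show ?thesis
      using y \<alpha> unfolding diffs_def c_def y_def[symmetric] y(2)[symmetric]
      by (simp add: y(2) field_simps del: of_nat_Suc)
  qed
  have "((\<lambda>x. \<Sum>k. c k * x ^ k) has_field_derivative (\<Sum>k. diffs c k * x ^ k)) (at x)"
    unfolding c_def using \<alpha>
    by (intro termdiffs_strong_converges_everywhere summable_mittag_leffler2_powser) auto
  moreover have "(\<Sum>k. diffs c k * x ^ k) = mittag_leffler2 \<alpha> \<alpha> x / \<alpha>"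
  proof -
    have "(\<Sum>k. diffs c k * x ^ k)
        = (\<Sum>k. inverse (Gamma (\<alpha> * real k + \<alpha>)) * x ^ k / \<alpha>)"
      by (simp add: d)
    also have "\<dots> = mittag_leffler2 \<alpha> \<alpha> x / \<alpha>"
      unfolding mittag_leffler2_powser
      by (rule suminf_divide[OF summable_mittag_leffler2_powser[OF \<alpha> \<alpha>]])
    finally show ?thesis .
  qed
  ultimately show ?thesis
    by (simp add: mittag_leffler_def[abs_def] mittag_leffler2_powser c_def)
qed

section \<open>Convolution of Mittag-Leffler densities\<close>

text \<open>
  The kernel of the Riemann-Liouville fractional integral of order \<open>a\<close>.
\<close>
definition rl_kernel :: "real \<Rightarrow> real \<Rightarrow> real" where
  "rl_kernel a t = (if 0 < t then t powr (a - 1) / Gamma a else 0)"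

lemma rl_kernel_nonneg: "a > 0 \<Longrightarrow> 0 \<le> rl_kernel a t"
  by (simp add: rl_kernel_def Gamma_real_nonneg)

lemma borel_measurable_rl_kernel [measurable]: "rl_kernel a \<in> borel_measurable borel"
  unfolding rl_kernel_def[abs_def] by measurable

text \<open>
  Fractional integrals compose by adding their orders. After the substitution \<open>y = t u\<close> this
  is Euler's Beta integral.
\<close>
lemma has_bochner_integral_rl_kernel_convolution:
  assumes a: "a > 0" and b: "b > 0"
  shows "has_bochner_integral lborel (\<lambda>y. rl_kernel a (t - y) * rl_kernel b y)
           (rl_kernel (a + b) t)"
proof (cases "t > 0")
  case False
  then have "(\<lambda>y. rl_kernel a (t - y) * rl_kernel b y) = (\<lambda>_. 0)"
    by (auto simp: rl_kernel_def)
  then show ?thesis using False by (simp add: rl_kernel_def has_bochner_integral_zero)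
next
  case t: True
  define C where "C = t powr (a + b - 2) / (Gamma a * Gamma b)"
  have C: "C \<ge> 0" using a b by (simp add: C_def Gamma_real_nonneg)
  have "((\<lambda>u. u powr (b - 1) * (1 - u) powr (a - 1)) has_integral Beta b a) {0..1}"
    by (rule has_integral_Beta_real[OF b a])
  then have "((\<lambda>u. C * (u powr (b - 1) * (1 - u) powr (a - 1))) has_integral C * Beta b a) {0..1}"
    by (rule has_integral_mult_right)
  then have "((\<lambda>u. if u \<in> {0..1} then C * (u powr (b - 1) * (1 - u) powr (a - 1)) else 0)
               has_integral C * Beta b a) UNIV"
    by (subst has_integral_restrict_UNIV)
  moreover have eq: "(if u \<in> {0..1} then C * (u powr (b - 1) * (1 - u) powr (a - 1)) else 0)
      = rl_kernel a (t - t * u) * rl_kernel b (t * u)" for u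
  proof (cases "0 < u \<and> u < 1")
    case True
    have "rl_kernel a (t - t * u) * rl_kernel b (t * u)
        = (t * (1 - u)) powr (a - 1) / Gamma a * ((t * u) powr (b - 1) / Gamma b)"
      using True t by (simp add: rl_kernel_def right_diff_distrib)
    also have "\<dots> = (t powr (a - 1) * t powr (b - 1)) / (Gamma a * Gamma b)
                     * (u powr (b - 1) * (1 - u) powr (a - 1))"
      using True t by (simp add: powr_mult)
    also have "t powr (a - 1) * t powr (b - 1) = t powr (a + b - 2)"
      unfolding powr_add[symmetric] by (simp add: algebra_simps)
    finally show ?thesis using True by (simp add: C_def)
  next
    case False
    then have "\<not> (0 < t * u \<and> 0 < t - t * u)"
      using t by (auto simp: zero_less_mult_iff)
    then have "rl_kernel a (t - t * u) * rl_kernel b (t * u) = 0"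
      by (auto simp: rl_kernel_def)
    moreover have "u \<in> {0..1} \<Longrightarrow> u = 0 \<or> u = 1" using False by auto
    ultimately show ?thesis by auto
  qed
  ultimately have I: "((\<lambda>u. rl_kernel a (t - t * u) * rl_kernel b (t * u)) has_integral C * Beta b a) UNIV"
    by simp
  have nn: "0 \<le> rl_kernel a x * rl_kernel b y" for x y
    using a b by (simp add: rl_kernel_nonneg)
  have "(\<integral>\<^sup>+u. ennreal (rl_kernel a (t - t * u) * rl_kernel b (t * u)) \<partial>lborel) = ennreal (C * Beta b a)"
    by (rule nn_integral_has_integral_lborel[OF _ nn I]) measurable
  moreover have "Beta b a \<ge> 0" using a b by (simp add: Beta_def Gamma_real_nonneg)
  ultimately have "has_bochner_integral lborel (\<lambda>u. rl_kernel a (t - t * u) * rl_kernel b (t * u)) (C * Beta b a)"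
    using nn C by (intro has_bochner_integral_nn_integral) auto
  moreover have "C * Beta b a = rl_kernel (a + b) t /\<^sub>R \<bar>t\<bar>"
  proof -
    have "t * t powr (a + b - 2) = t powr (a + b - 1)"
      using t powr_add[of t 1 "a + b - 2"] by simp
    moreover have "Gamma a \<noteq> 0" "Gamma b \<noteq> 0" "Gamma (a + b) \<noteq> 0"
      using a b by (simp_all add: Gamma_real_pos less_imp_neq[symmetric])
    ultimately show ?thesis
      using t by (simp add: C_def Beta_def rl_kernel_def add.commute[of b a] field_simps)
  qed
  ultimately show ?thesis
    using t lborel_has_bochner_integral_real_affine_iff
      [of t "\<lambda>y. rl_kernel a (t - y) * rl_kernel b y" "rl_kernel (a + b) t" 0]
    by simp
qed

definition mittag_leffler_density :: "real \<Rightarrow> real \<Rightarrow> real \<Rightarrow> real" where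
  "mittag_leffler_density \<alpha> l t =
     (if 0 < t then t powr (\<alpha> - 1) * (l * mittag_leffler2 \<alpha> \<alpha> (- l * t powr \<alpha>)) else 0)"

lemma rl_kernel_shift:
  assumes "t > 0"
  shows "rl_kernel (\<alpha> * real k + \<beta>) t = t powr (\<beta> - 1) * ((t powr \<alpha>) ^ k / Gamma (\<alpha> * real k + \<beta>))"
proof -
  have "t powr (\<alpha> * real k + \<beta> - 1) = t powr (\<beta> - 1) * t powr (\<alpha> * real k)"
    using assms by (simp add: powr_add[symmetric] algebra_simps)
  also have "t powr (\<alpha> * real k) = (t powr \<alpha>) ^ k"
    using assms by (simp add: powr_powr[symmetric] powr_realpow)
  finally show ?thesis using assms by (simp add: rl_kernel_def)
qed

lemma summable_norm_rl_kernel_powser: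
  assumes "\<alpha> > 0" and "\<beta> > 0"
  shows "summable (\<lambda>k. norm (c ^ k * rl_kernel (\<alpha> * real k + \<beta>) t))"
proof (cases "t > 0")
  case True
  have "c ^ k * rl_kernel (\<alpha> * real k + \<beta>) t
      = t powr (\<beta> - 1) * ((c * t powr \<alpha>) ^ k / Gamma (\<alpha> * real k + \<beta>))" for k
    using True by (simp add: rl_kernel_shift power_mult_distrib)
  then show ?thesis
    using summable_mult[OF summable_norm_mittag_leffler2[OF assms, of "c * t powr \<alpha>"], of "t powr (\<beta> - 1)"]
    by (simp add: abs_mult)
qed (simp add: rl_kernel_def)

text \<open>
  The geometric series \<open>\<Sum>k. l (-l)\<^sup>k p\<^sup>k\<^sup>+\<^sup>1\<close> of \<open>l p / (1 + l p)\<close>, where the powers of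
  \<open>p = rl_kernel \<alpha>\<close> are taken with respect to convolution.
\<close>
lemma mittag_leffler_density_sums:
  assumes \<alpha>: "\<alpha> > 0"
  shows "(\<lambda>k. l * ((- l) ^ k * rl_kernel (\<alpha> * real k + \<alpha>) t)) sums mittag_leffler_density \<alpha> l t"
proof (cases "t > 0")
  case True
  have "(\<lambda>k. (- l * t powr \<alpha>) ^ k / Gamma (\<alpha> * real k + \<alpha>)) sums mittag_leffler2 \<alpha> \<alpha> (- l * t powr \<alpha>)"
    unfolding mittag_leffler2_def
    by (intro summable_sums summable_norm_cancel[OF summable_norm_mittag_leffler2[OF \<alpha> \<alpha>]])
  from sums_mult[OF this, of "t powr (\<alpha> - 1) * l"]
  have "(\<lambda>k. t powr (\<alpha> - 1) * l * ((- l * t powr \<alpha>) ^ k / Gamma (\<alpha> * real k + \<alpha>)))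
          sums mittag_leffler_density \<alpha> l t"
    using True by (simp add: mittag_leffler_density_def mult.assoc)
  moreover have "t powr (\<alpha> - 1) * l * ((- l * t powr \<alpha>) ^ k / Gamma (\<alpha> * real k + \<alpha>))
     = l * ((- l) ^ k * rl_kernel (\<alpha> * real k + \<alpha>) t)" for k
    using True by (subst rl_kernel_shift) (simp_all only: power_mult_distrib, simp)
  ultimately show ?thesis by simp
qed (simp add: rl_kernel_def mittag_leffler_density_def)

lemma borel_measurable_mittag_leffler_density [measurable]:
  assumes "\<alpha> > 0"
  shows "mittag_leffler_density \<alpha> l \<in> borel_measurable borel"
proof -
  have "continuous_on UNIV (mittag_leffler2 \<alpha> \<alpha>)"
    using isCont_mittag_leffler2[OF assms assms] by (simp add: continuous_at_imp_continuous_on)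
  then have [measurable]: "mittag_leffler2 \<alpha> \<alpha> \<in> borel_measurable borel"
    by (rule borel_measurable_continuous_onI)
  show ?thesis
    unfolding mittag_leffler_density_def[abs_def] by measurable
qed

text \<open>
  Partial fractions in the convolution algebra. The functions \<open>h k\<close> below collect the terms of
  the Cauchy product that contain the convolution power \<open>p\<^sup>k\<^sup>+\<^sup>2\<close>, so their integrals are
  multiples of a single kernel, and these multiples are homogeneous sums in \<open>-l\<close> and \<open>-m\<close> that
  telescope after multiplication by \<open>m - l\<close>.
\<close>
lemma has_bochner_integral_mittag_leffler_convolution:
  assumes \<alpha>: "\<alpha> > 0" and lm: "l \<noteq> m"
  shows "has_bochner_integral lborel
           (\<lambda>y. mittag_leffler_density \<alpha> l (t - y) * mittag_leffler_density \<alpha> m y)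
           (m / (m - l) * mittag_leffler_density \<alpha> l t + l / (l - m) * mittag_leffler_density \<alpha> m t)"
proof -
  define a where "a = (\<lambda>c k u. c * ((- c) ^ k * rl_kernel (\<alpha> * real k + \<alpha>) u))"
  define h where "h = (\<lambda>k y. \<Sum>i\<le>k. a l i (t - y) * a m (k - i) y)"
  have sa: "summable (\<lambda>k. norm (a c k u))" for c u
    using summable_mult[OF summable_norm_rl_kernel_powser[OF \<alpha> \<alpha>], of "\<bar>c\<bar>" "- c" u]
    by (simp add: a_def abs_mult)
  have a_sum: "(\<Sum>k. a c k u) = mittag_leffler_density \<alpha> c u" for c u
    using mittag_leffler_density_sums[OF \<alpha>, of c u] by (simp add: a_def sums_iff)
  have h_sums: "(\<lambda>k. h k y) sums (mittag_leffler_density \<alpha> l (t - y) * mittag_leffler_density \<alpha> m y)" for y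
    using Cauchy_product_sums[OF sa sa] by (simp add: h_def a_sum)
  have h_abs: "summable (\<lambda>k. norm (h k y))" for y
  proof -
    have bound: "norm (norm (h k y)) \<le> (\<Sum>i\<le>k. norm (a l i (t - y)) * norm (a m (k - i) y))" for k
      unfolding h_def real_norm_def abs_idempotent abs_mult[symmetric] by (rule sum_abs)
    have "summable (\<lambda>k. \<Sum>i\<le>k. norm (a l i (t - y)) * norm (a m (k - i) y))"
      using sa by (intro summable_Cauchy_product) auto
    then show ?thesis
      by (rule summable_comparison_test'[where N = 0]) (rule bound)
  qed
  have kernel: "has_bochner_integral lborel
      (\<lambda>y. rl_kernel (\<alpha> * real i + \<alpha>) (t - y) * rl_kernel (\<alpha> * real (k - i) + \<alpha>) y)
      (rl_kernel (\<alpha> * real k + 2 * \<alpha>) t)" if "i \<le> k" for i k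
  proof -
    have "\<alpha> * real i + \<alpha> + (\<alpha> * real (k - i) + \<alpha>) = \<alpha> * real k + 2 * \<alpha>"
      using that by (simp add: of_nat_diff algebra_simps)
    moreover have "0 < \<alpha> * real j + \<alpha>" for j
      using \<alpha> by (simp add: add_nonneg_pos)
    ultimately show ?thesis
      using has_bochner_integral_rl_kernel_convolution[of "\<alpha> * real i + \<alpha>" "\<alpha> * real (k - i) + \<alpha>" t]
      by metis
  qed
  have summand: "has_bochner_integral lborel (\<lambda>y. a l i (t - y) * a m (k - i) y)
      ((l * m * ((- l) ^ i * (- m) ^ (k - i))) * rl_kernel (\<alpha> * real k + 2 * \<alpha>) t)" if "i \<le> k" for i k
    using has_bochner_integral_mult_right[OF kernel[OF that], of "l * m * ((- l) ^ i * (- m) ^ (k - i))"]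
    by (simp add: a_def mult_ac)
  have h_int: "has_bochner_integral lborel (h k)
      (\<Sum>i\<le>k. (l * m * ((- l) ^ i * (- m) ^ (k - i))) * rl_kernel (\<alpha> * real k + 2 * \<alpha>) t)" for k
    unfolding h_def by (intro has_bochner_integral_sum summand) auto
  define S where "S = (\<lambda>k. \<Sum>i\<le>k. (- l) ^ i * (- m) ^ (k - i))"
  have h_integral: "integral\<^sup>L lborel (h k) = l * m * S k * rl_kernel (\<alpha> * real k + 2 * \<alpha>) t" for k
    using has_bochner_integral_integral_eq[OF h_int[of k]]
    by (simp add: S_def sum_distrib_left sum_distrib_right)
  have kernel_nn: "0 \<le> rl_kernel (\<alpha> * real k + \<beta>) u" if "\<beta> > 0" for k \<beta> u
    using \<alpha> that by (intro rl_kernel_nonneg) (simp add: add_nonneg_pos)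
  \<comment> \<open>Each of the \<open>k + 1\<close> terms of \<open>h k\<close> has absolute integral at most \<open>\<bar>l m\<bar> R\<^sup>k\<close> times
      the kernel at \<open>t\<close>, with \<open>R = max \<bar>l\<bar> \<bar>m\<bar>\<close>; the factor \<open>k + 1\<close> is absorbed by \<open>2\<^sup>k\<close>.\<close>
  have h_norm: "(\<integral>y. norm (h k y) \<partial>lborel)
      \<le> \<bar>l * m\<bar> * norm ((2 * max \<bar>l\<bar> \<bar>m\<bar>) ^ k * rl_kernel (\<alpha> * real k + 2 * \<alpha>) t)" for k
  proof -
    define R where "R = max \<bar>l\<bar> \<bar>m\<bar>"
    have R: "0 \<le> R" "\<bar>l\<bar> \<le> R" "\<bar>m\<bar> \<le> R" by (auto simp: R_def)
    let ?K = "rl_kernel (\<alpha> * real k + 2 * \<alpha>) t"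
    have tm: "has_bochner_integral lborel (\<lambda>y. norm (a l i (t - y) * a m (k - i) y))
       (\<bar>l * m\<bar> * (\<bar>l\<bar> ^ i * \<bar>m\<bar> ^ (k - i)) * ?K)" if "i \<le> k" for i
      using has_bochner_integral_mult_right[OF kernel[OF that], of "\<bar>l * m\<bar> * (\<bar>l\<bar> ^ i * \<bar>m\<bar> ^ (k - i))"]
      by (simp add: a_def abs_mult power_abs kernel_nn \<alpha> mult_ac)
    then have si: "has_bochner_integral lborel (\<lambda>y. \<Sum>i\<le>k. norm (a l i (t - y) * a m (k - i) y))
       (\<Sum>i\<le>k. \<bar>l * m\<bar> * (\<bar>l\<bar> ^ i * \<bar>m\<bar> ^ (k - i)) * ?K)"
      by (intro has_bochner_integral_sum) auto
    have "(\<integral>y. norm (h k y) \<partial>lborel)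
        \<le> (\<integral>y. (\<Sum>i\<le>k. norm (a l i (t - y) * a m (k - i) y)) \<partial>lborel)"
      using h_int[of k] si
      by (intro integral_mono) (auto simp: has_bochner_integral_iff h_def intro: sum_abs)
    also have "\<dots> = (\<Sum>i\<le>k. \<bar>l * m\<bar> * (\<bar>l\<bar> ^ i * \<bar>m\<bar> ^ (k - i)) * ?K)"
      using si by (rule has_bochner_integral_integral_eq)
    also have "\<dots> \<le> (\<Sum>i\<le>k. \<bar>l * m\<bar> * (R ^ i * R ^ (k - i)) * ?K)"
      using R \<alpha> by (intro sum_mono mult_right_mono mult_left_mono mult_mono power_mono kernel_nn) auto
    also have "\<dots> = (\<Sum>i\<le>k. \<bar>l * m\<bar> * R ^ k * ?K)"
      by (intro sum.cong) (auto simp: power_add[symmetric])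
    also have "\<dots> = \<bar>l * m\<bar> * (real (k + 1) * (R ^ k * ?K))"
      by simp
    also have "\<dots> \<le> \<bar>l * m\<bar> * (2 ^ k * (R ^ k * ?K))"
    proof -
      have "k + 1 \<le> 2 ^ k" by (induction k) auto
      then have "real (k + 1) \<le> 2 ^ k" by (metis of_nat_le_iff of_nat_numeral of_nat_power)
      then show ?thesis
        using R \<alpha> by (intro mult_left_mono mult_right_mono mult_nonneg_nonneg kernel_nn) auto
    qed
    also have "\<dots> = \<bar>l * m\<bar> * norm ((2 * R) ^ k * ?K)"
      using R \<alpha> by (simp add: abs_mult kernel_nn power_mult_distrib)
    finally show ?thesis by (simp add: R_def)
  qed
  have h_norm_sum: "summable (\<lambda>k. \<integral>y. norm (h k y) \<partial>lborel)"
  proof (rule summable_comparison_test'[where N = 0])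
    show "summable (\<lambda>k. \<bar>l * m\<bar> * norm ((2 * max \<bar>l\<bar> \<bar>m\<bar>) ^ k * rl_kernel (\<alpha> * real k + 2 * \<alpha>) t))"
      using \<alpha> by (intro summable_mult summable_norm_rl_kernel_powser) auto
    have "0 \<le> (\<integral>y. norm (h k y) \<partial>lborel)" for k
      by (rule integral_nonneg_AE) simp
    then show "norm (\<integral>y. norm (h k y) \<partial>lborel)
      \<le> \<bar>l * m\<bar> * norm ((2 * max \<bar>l\<bar> \<bar>m\<bar>) ^ k * rl_kernel (\<alpha> * real k + 2 * \<alpha>) t)" for k
      using h_norm[of k] by (simp only: real_norm_def abs_of_nonneg)
  qed
  have h_integrable: "integrable lborel (h k)" for k
    using h_int[of k] by (simp add: has_bochner_integral_iff)
  have prod_eq: "(\<lambda>y. \<Sum>k. h k y) = (\<lambda>y. mittag_leffler_density \<alpha> l (t - y) * mittag_leffler_density \<alpha> m y)"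
    using h_sums by (simp add: sums_iff fun_eq_iff)
  have int: "integrable lborel (\<lambda>y. \<Sum>k. h k y)"
    by (rule integrable_suminf[OF h_integrable _ h_norm_sum]) (use h_abs in auto)
  have "(\<lambda>k. integral\<^sup>L lborel (h k)) sums (\<integral>y. (\<Sum>k. h k y) \<partial>lborel)"
    by (rule sums_integral[OF h_integrable _ h_norm_sum]) (use h_abs in auto)
  from sums_mult[OF this, of "m - l"]
  have 1: "(\<lambda>k. (m - l) * (l * m * S k * rl_kernel (\<alpha> * real k + 2 * \<alpha>) t))
      sums ((m - l) * (\<integral>y. (\<Sum>k. h k y) \<partial>lborel))"
    by (simp add: h_integral)
  have 2: "(\<lambda>k. m * a l k t - l * a m k t) sums
      (m * mittag_leffler_density \<alpha> l t - l * mittag_leffler_density \<alpha> m t)"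
    using mittag_leffler_density_sums[OF \<alpha>] unfolding a_def by (intro sums_diff sums_mult) auto
  \<comment> \<open>The terms of order \<open>p\<close> cancel on the right-hand side, which matches the product on the
      left starting at order \<open>p\<^sup>2\<close>; hence the shift of the summation index by one.\<close>
  have zero: "m * a l 0 t - l * a m 0 t = 0" by (simp add: a_def)
  have step: "m * a l (Suc k) t - l * a m (Suc k) t
      = (m - l) * (l * m * S k * rl_kernel (\<alpha> * real k + 2 * \<alpha>) t)" for k
  proof -
    have "(- l) ^ Suc k - (- m) ^ Suc k = (m - l) * S k"
      using diff_power_eq_sum[of "- l" k "- m"] by (simp add: S_def lessThan_Suc_atMost)
    moreover have "\<alpha> * real (Suc k) + \<alpha> = \<alpha> * real k + 2 * \<alpha>"
      by (simp add: algebra_simps)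
    moreover have "m * (l * (x * K)) - l * (m * (y * K)) = l * m * (x - y) * K" for x y K :: real
      by algebra
    ultimately have "m * a l (Suc k) t - l * a m (Suc k) t
        = l * m * ((m - l) * S k) * rl_kernel (\<alpha> * real k + 2 * \<alpha>) t"
      unfolding a_def by (simp only:)
    then show ?thesis by simp
  qed
  have "(\<lambda>k. m * a l (Suc k) t - l * a m (Suc k) t) sums
      (m * mittag_leffler_density \<alpha> l t - l * mittag_leffler_density \<alpha> m t)"
    using 2 zero by (subst sums_Suc_iff) simp
  then have "(\<lambda>k. (m - l) * (l * m * S k * rl_kernel (\<alpha> * real k + 2 * \<alpha>) t))
      sums (m * mittag_leffler_density \<alpha> l t - l * mittag_leffler_density \<alpha> m t)"
    unfolding step .
  with 1 have "(m - l) * (\<integral>y. (\<Sum>k. h k y) \<partial>lborel)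
      = m * mittag_leffler_density \<alpha> l t - l * mittag_leffler_density \<alpha> m t"
    by (rule sums_unique2)
  then have "(\<integral>y. (\<Sum>k. h k y) \<partial>lborel)
      = (m * mittag_leffler_density \<alpha> l t - l * mittag_leffler_density \<alpha> m t) / (m - l)"
    using lm by (simp add: nonzero_eq_divide_eq mult.commute)
  also have "\<dots> = m / (m - l) * mittag_leffler_density \<alpha> l t - l / (m - l) * mittag_leffler_density \<alpha> m t"
    by (simp add: diff_divide_distrib)
  also have "l / (m - l) = - (l / (l - m))"
    by (metis minus_diff_eq minus_divide_right)
  finally have "(\<integral>y. (\<Sum>k. h k y) \<partial>lborel)
      = m / (m - l) * mittag_leffler_density \<alpha> l t + l / (l - m) * mittag_leffler_density \<alpha> m t"
    by simp
  with int show ?thesis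
    by (simp add: has_bochner_integral_iff prod_eq)
qed

section \<open>A Mittag-Leffler tail has a density\<close>

lemma DERIV_mittag_leffler_tail:
  assumes \<alpha>: "\<alpha> > 0" and t: "t > 0"
  shows "((\<lambda>t. mittag_leffler \<alpha> (- l * t powr \<alpha>)) has_field_derivative
            - mittag_leffler_density \<alpha> l t) (at t)"
proof -
  have "((\<lambda>t. - l * t powr \<alpha>) has_field_derivative - l * (\<alpha> * t powr (\<alpha> - 1))) (at t)"
    using t by (intro DERIV_cmult has_real_derivative_powr) auto
  from DERIV_chain2[OF DERIV_mittag_leffler[OF \<alpha>] this]
  show ?thesis
    by (rule DERIV_cong) (use \<alpha> t in \<open>simp add: mittag_leffler_density_def\<close>)
qed

lemma isCont_mittag_leffler_density:
  assumes \<alpha>: "\<alpha> > 0" and t: "t > 0"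
  shows "isCont (mittag_leffler_density \<alpha> l) t"
proof -
  have "isCont (\<lambda>t. t powr (\<alpha> - 1) * (l * mittag_leffler2 \<alpha> \<alpha> (- l * t powr \<alpha>))) t"
    using t by (intro continuous_intros isCont_o2[OF _ isCont_mittag_leffler2[OF \<alpha> \<alpha>]]) auto
  moreover have "eventually (\<lambda>s. mittag_leffler_density \<alpha> l s =
      s powr (\<alpha> - 1) * (l * mittag_leffler2 \<alpha> \<alpha> (- l * s powr \<alpha>))) (nhds t)"
    using eventually_nhds_in_open[of "{0<..}" t] t
    by (auto simp: mittag_leffler_density_def elim!: eventually_mono)
  ultimately show ?thesis by (simp add: isCont_cong)
qed

context prob_space
begin

text \<open>
  Nonnegativity is a consequence of the existence of \<open>X\<close>: at a point where the density were
  negative, the tail would be strictly increasing.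
\<close>
lemma mittag_leffler_density_nonneg:
  assumes \<alpha>: "\<alpha> > 0" and X [measurable]: "random_variable borel X"
    and tail: "\<And>t. 0 \<le> t \<Longrightarrow> prob {\<omega> \<in> space M. X \<omega> > t} = mittag_leffler \<alpha> (- l * t powr \<alpha>)"
  shows "0 \<le> mittag_leffler_density \<alpha> l t"
proof (rule ccontr)
  assume neg: "\<not> 0 \<le> mittag_leffler_density \<alpha> l t"
  then have t: "t > 0" by (auto simp: mittag_leffler_density_def split: if_splits)
  let ?T = "\<lambda>t. mittag_leffler \<alpha> (- l * t powr \<alpha>)"
  obtain d where d: "d > 0" "\<And>h. h > 0 \<Longrightarrow> h < d \<Longrightarrow> ?T t < ?T (t + h)"
    using DERIV_pos_inc_right[OF DERIV_mittag_leffler_tail[OF \<alpha> t, of l]] neg by auto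
  have "?T t < ?T (t + d / 2)" using d by simp
  moreover have "prob {\<omega> \<in> space M. X \<omega> > t + d / 2} \<le> prob {\<omega> \<in> space M. X \<omega> > t}"
    using d(1) by (intro finite_measure_mono) auto
  ultimately show False
    using tail[of t] tail[of "t + d / 2"] t d(1) by simp
qed

text \<open>
  The density may blow up at \<open>0\<close>, so the fundamental theorem of calculus is used on the open
  interval \<open>(0, a)\<close>, where nonnegativity gives integrability and only the limits of the tail at
  the ends enter. The value \<open>E\<^sub>\<alpha>(0) = 1\<close> of the tail at \<open>0\<close> means that \<open>X\<close> is almost
  surely positive.
\<close>
lemma distributed_mittag_leffler:
  assumes \<alpha>: "\<alpha> > 0" and X [measurable]: "random_variable borel X"
    and tail: "\<And>t. 0 \<le> t \<Longrightarrow> prob {\<omega> \<in> space M. X \<omega> > t} = mittag_leffler \<alpha> (- l * t powr \<alpha>)"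
  shows "distributed M lborel X (\<lambda>t. ennreal (mittag_leffler_density \<alpha> l t))"
proof -
  let ?g = "mittag_leffler_density \<alpha> l"
  define T where "T = (\<lambda>t. mittag_leffler \<alpha> (- l * t powr \<alpha>))"
  have nonneg: "0 \<le> ?g t" for t
    using mittag_leffler_density_nonneg[OF \<alpha> X tail] .
  have le: "prob {\<omega> \<in> space M. X \<omega> \<le> a} = 1 - T a" if "a \<ge> 0" for a
  proof -
    have "prob {\<omega> \<in> space M. X \<omega> \<le> a} = 1 - prob {\<omega> \<in> space M. X \<omega> > a}"
      by (subst prob_compl[symmetric]) (auto intro!: arg_cong[of _ _ prob])
    then show ?thesis using tail[OF that] by (simp add: T_def)
  qed
  have T0: "T 0 = 1" by (simp add: T_def)
  have le_neg: "prob {\<omega> \<in> space M. X \<omega> \<le> a} = 0" if "a < 0" for a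
  proof -
    have "prob {\<omega> \<in> space M. X \<omega> \<le> a} \<le> prob {\<omega> \<in> space M. X \<omega> \<le> 0}"
      using that by (intro finite_measure_mono) auto
    then show ?thesis using le[of 0] T0 by (simp add: measure_le_0_iff)
  qed
  have int: "(\<integral>\<^sup>+t. ennreal (?g t * indicator {..a} t) \<partial>lborel) = ennreal (1 - T a)" if a: "a > 0" for a
  proof -
    have deriv: "((\<lambda>t. - T t) has_field_derivative ?g t) (at t)" if "t > 0" for t
      using DERIV_minus[OF DERIV_mittag_leffler_tail[OF \<alpha> that, of l]] by (simp add: T_def)
    have "eventually (\<lambda>t::real. 0 \<le> t) (at_right 0)"
      by (rule eventually_mono[OF eventually_at_right_less]) simp
    then have "((\<lambda>t. t powr \<alpha>) \<longlongrightarrow> 0) (at_right 0)"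
      using \<alpha> by (intro tendsto_zero_powrI[where b = \<alpha>]) (auto intro!: tendsto_intros)
    then have "((\<lambda>t. - l * t powr \<alpha>) \<longlongrightarrow> - l * 0) (at_right 0)"
      by (rule tendsto_mult_left)
    then have "(T \<longlongrightarrow> 1) (at_right 0)"
      unfolding T_def
      using isCont_tendsto_compose[OF isCont_mittag_leffler[OF \<alpha>], of "\<lambda>t. - l * t powr \<alpha>" "- l * 0" "at_right 0"]
      by simp
    then have lim0: "(((\<lambda>t. - T t) \<circ> real_of_ereal) \<longlongrightarrow> - 1) (at_right (ereal 0))"
      unfolding ereal_tendsto_simps by (rule tendsto_minus)
    have "isCont (\<lambda>t. - T t) a" using deriv[OF a] by (rule DERIV_isCont)
    then have "((\<lambda>t. - T t) \<longlongrightarrow> - T a) (at_left a)"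
      by (auto simp: isCont_def intro: tendsto_mono[OF at_le])
    then have lima: "(((\<lambda>t. - T t) \<circ> real_of_ereal) \<longlongrightarrow> - T a) (at_left (ereal a))"
      unfolding ereal_tendsto_simps .
    note FTC = interval_integral_FTC_nonneg[OF _ _ _ _ lim0 lima, of ?g]
    have si: "set_integrable lborel (einterval (ereal 0) (ereal a)) ?g"
      by (rule FTC(1)) (use a nonneg \<alpha> in \<open>auto intro!: isCont_mittag_leffler_density deriv\<close>)
    have "(LBINT t=ereal 0..ereal a. ?g t) = - T a - (- 1)"
      by (rule FTC(2)) (use a nonneg \<alpha> in \<open>auto intro!: isCont_mittag_leffler_density deriv\<close>)
    then have I: "(LBINT t:{0<..<a}. ?g t) = 1 - T a"
      using a by (simp add: interval_integral_Ioo)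
    have "(\<integral>\<^sup>+t. ennreal (?g t * indicator {..a} t) \<partial>lborel)
        = (\<integral>\<^sup>+t. ennreal (indicator {0<..<a} t *\<^sub>R ?g t) \<partial>lborel)"
    proof (rule nn_integral_cong_AE, rule AE_mp[OF AE_lborel_singleton[of a]], rule AE_I2, rule impI)
      fix t :: real assume "t \<noteq> a"
      then show "ennreal (?g t * indicator {..a} t) = ennreal (indicator {0<..<a} t *\<^sub>R ?g t)"
        by (auto simp: mittag_leffler_density_def split: split_indicator)
    qed
    also have "\<dots> = ennreal (LBINT t:{0<..<a}. ?g t)"
      using si nonneg unfolding set_integrable_def set_lebesgue_integral_def
      by (intro nn_integral_eq_integral) auto
    finally show ?thesis using I by simp
  qed
  show ?thesis
  proof (rule distributedI_borel_atMost[where g = "\<lambda>a. if a \<le> 0 then 0 else 1 - T a"])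
    fix a
    show "(\<integral>\<^sup>+t. ennreal (?g t * indicator {..a} t) \<partial>lborel) = ennreal (if a \<le> 0 then 0 else 1 - T a)"
    proof (cases "a \<le> 0")
      case True
      then have "(\<integral>\<^sup>+t. ennreal (?g t * indicator {..a} t) \<partial>lborel) = (\<integral>\<^sup>+t. 0 \<partial>(lborel :: real measure))"
        by (intro nn_integral_cong) (auto simp: mittag_leffler_density_def split: split_indicator)
      then show ?thesis using True by simp
    qed (use int in auto)
    show "emeasure M {x \<in> space M. X x \<le> a} = ennreal (if a \<le> 0 then 0 else 1 - T a)"
      using le[of a] le_neg[of a] T0 by (cases "a = 0") (auto simp: emeasure_eq_measure)
  qed (use \<alpha> nonneg in auto)
qed

lemma has_bochner_integral_density_atMost:
  fixes f :: "real \<Rightarrow> real"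
  assumes D: "distributed M lborel X (\<lambda>t. ennreal (f t))"
    and [measurable]: "f \<in> borel_measurable borel" and nonneg: "\<And>t. 0 \<le> f t"
  shows "has_bochner_integral lborel (\<lambda>t. f t * indicator {..a} t) (prob {\<omega> \<in> space M. X \<omega> \<le> a})"
proof (rule has_bochner_integral_nn_integral)
  have "emeasure M (X -` {..a} \<inter> space M) = (\<integral>\<^sup>+t. ennreal (f t) * indicator {..a} t \<partial>lborel)"
    by (rule distributed_emeasure[OF D]) simp
  moreover have "X -` {..a} \<inter> space M = {\<omega> \<in> space M. X \<omega> \<le> a}" by auto
  moreover have "(\<integral>\<^sup>+t. ennreal (f t) * indicator {..a} t \<partial>lborel)
      = (\<integral>\<^sup>+t. ennreal (f t * indicator {..a} t) \<partial>lborel)"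
    by (intro nn_integral_cong) (auto split: split_indicator)
  ultimately show "(\<integral>\<^sup>+t. ennreal (f t * indicator {..a} t) \<partial>lborel) = ennreal (prob {\<omega> \<in> space M. X \<omega> \<le> a})"
    by (simp add: emeasure_eq_measure)
qed (use nonneg in auto)

end

section \<open>Partial fractions\<close>

text \<open>
  The coefficient of \<open>lam i / (lam i - x)\<close> in the partial fraction decomposition of
  \<open>\<Prod>k\<in>A. lam k / (lam k - x)\<close>.
\<close>
definition partial_fraction_coeff :: "('i \<Rightarrow> real) \<Rightarrow> 'i set \<Rightarrow> 'i \<Rightarrow> real" where
  "partial_fraction_coeff lam A i = (\<Prod>k\<in>A - {i}. lam k / (lam k - lam i))"

lemma partial_fraction_coeff_insert:
  assumes "finite A" "a \<notin> A" "i \<in> A"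
  shows "partial_fraction_coeff lam (insert a A) i = lam a / (lam a - lam i) * partial_fraction_coeff lam A i"
proof -
  have "insert a A - {i} = insert a (A - {i})" using assms by auto
  then show ?thesis using assms by (simp add: partial_fraction_coeff_def)
qed

lemma partial_fraction_coeff_insert_new:
  assumes "a \<notin> A"
  shows "partial_fraction_coeff lam (insert a A) a = (\<Prod>k\<in>A. lam k / (lam k - lam a))"
  using assms by (simp add: partial_fraction_coeff_def)

lemma partial_fraction_two:
  fixes l m x :: real
  assumes "x \<noteq> l" "x \<noteq> m" "l \<noteq> m"
  shows "l / (l - x) * (m / (m - x)) = m / (m - l) * (l / (l - x)) + l / (l - m) * (m / (m - x))"
  using assms by (simp add: divide_simps, simp add: algebra_simps)

text \<open>
  In the induction step each old fraction is multiplied by the new factor and split by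
  \<open>partial_fraction_two\<close>. The coefficients that accumulate at the new pole \<open>lam a\<close> form the old
  partial fraction sum at \<open>x = lam a\<close>, which the induction hypothesis evaluates; this is why
  \<open>x\<close> is generalised.
\<close>
lemma partial_fraction_decomposition:
  fixes lam :: "'i \<Rightarrow> real"
  assumes "finite A" "A \<noteq> {}" "inj_on lam A" "x \<notin> lam ` A"
  shows "(\<Prod>k\<in>A. lam k / (lam k - x)) = (\<Sum>i\<in>A. partial_fraction_coeff lam A i * (lam i / (lam i - x)))"
  using assms
proof (induction A arbitrary: x rule: finite_ne_induct)
  case (singleton i)
  then show ?case by (simp add: partial_fraction_coeff_def)
next
  case (insert a A)
  let ?c = "partial_fraction_coeff lam A"
  have inj: "inj_on lam A" and a: "lam a \<notin> lam ` A" and x: "x \<notin> lam ` A" "x \<noteq> lam a"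
    using insert.prems insert.hyps by auto
  have "(\<Prod>k\<in>insert a A. lam k / (lam k - x)) = (\<Sum>i\<in>A. ?c i * (lam i / (lam i - x) * (lam a / (lam a - x))))"
    using insert.hyps insert.IH[OF inj x(1)]
    by (simp add: sum_distrib_left sum_distrib_right mult_ac)
  also have "\<dots> = (\<Sum>i\<in>A. lam a / (lam a - lam i) * ?c i * (lam i / (lam i - x))
      + ?c i * (lam i / (lam i - lam a)) * (lam a / (lam a - x)))"
  proof (rule sum.cong)
    fix i assume "i \<in> A"
    then have "x \<noteq> lam i" "lam i \<noteq> lam a" using a x by (metis imageI)+
    from partial_fraction_two[OF this(1) x(2) this(2)]
    show "?c i * (lam i / (lam i - x) * (lam a / (lam a - x)))
      = lam a / (lam a - lam i) * ?c i * (lam i / (lam i - x))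
      + ?c i * (lam i / (lam i - lam a)) * (lam a / (lam a - x))"
      by (simp only: distrib_left mult_ac)
  qed simp
  also have "\<dots> = (\<Sum>i\<in>A. partial_fraction_coeff lam (insert a A) i * (lam i / (lam i - x)))
      + (\<Sum>i\<in>A. ?c i * (lam i / (lam i - lam a))) * (lam a / (lam a - x))"
    using insert.hyps
    by (simp add: sum.distrib sum_distrib_right sum_divide_distrib partial_fraction_coeff_insert cong: sum.cong)
  also have "(\<Sum>i\<in>A. ?c i * (lam i / (lam i - lam a))) = partial_fraction_coeff lam (insert a A) a"
    using insert.hyps insert.IH[OF inj a] by (simp add: partial_fraction_coeff_insert_new)
  finally show ?case using insert.hyps by simp
qed

text \<open>
  The decomposition at \<open>x = 0\<close>, where every factor equals 1.
\<close>
lemma sum_partial_fraction_coeff: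
  assumes "finite A" "A \<noteq> {}" "inj_on lam A" and pos: "\<And>i. i \<in> A \<Longrightarrow> 0 < lam i"
  shows "(\<Sum>i\<in>A. partial_fraction_coeff lam A i) = 1"
proof -
  have "0 \<notin> lam ` A" using pos by force
  from partial_fraction_decomposition[OF assms(1-3) this]
  have "(\<Prod>k\<in>A. lam k / lam k) = (\<Sum>i\<in>A. partial_fraction_coeff lam A i * (lam i / lam i))"
    by simp
  moreover have "(\<Prod>k\<in>A. lam k / lam k) = 1" using pos by (intro prod.neutral) force
  moreover have "(\<Sum>i\<in>A. partial_fraction_coeff lam A i * (lam i / lam i))
      = (\<Sum>i\<in>A. partial_fraction_coeff lam A i)" using pos by (intro sum.cong) (force simp: less_imp_neq)+
  ultimately show ?thesis by simp
qed

section \<open>Sums of independent Mittag-Leffler variables\<close>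

text \<open>
  A mixture with signed weights: for distinct positive rates the coefficients sum to 1 but
  alternate in sign when the rates are put in increasing order.
\<close>
definition mittag_leffler_mixture :: "real \<Rightarrow> ('i \<Rightarrow> real) \<Rightarrow> 'i set \<Rightarrow> real \<Rightarrow> real" where
  "mittag_leffler_mixture \<alpha> lam A t =
     (\<Sum>i\<in>A. partial_fraction_coeff lam A i * mittag_leffler_density \<alpha> (lam i) t)"

lemma borel_measurable_mittag_leffler_mixture [measurable]:
  "\<alpha> > 0 \<Longrightarrow> mittag_leffler_mixture \<alpha> lam A \<in> borel_measurable borel"
  unfolding mittag_leffler_mixture_def[abs_def] by measurable

text \<open>
  Convolving with one more density multiplies the old weights by \<open>lam a / (lam a - lam i)\<close>. The
  new weight is a partial fraction sum at \<open>x = lam a\<close>.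
\<close>
lemma has_bochner_integral_mixture_convolution:
  assumes \<alpha>: "\<alpha> > 0" and A: "finite A" "A \<noteq> {}" "a \<notin> A" and inj: "inj_on lam (insert a A)"
  shows "has_bochner_integral lborel
           (\<lambda>y. mittag_leffler_density \<alpha> (lam a) (t - y) * mittag_leffler_mixture \<alpha> lam A y)
           (mittag_leffler_mixture \<alpha> lam (insert a A) t)"
proof -
  let ?c = "partial_fraction_coeff lam A" and ?g = "\<lambda>i. mittag_leffler_density \<alpha> (lam i)"
  have ne: "lam a \<noteq> lam i" if "i \<in> A" for i
    using inj A that by auto
  have "has_bochner_integral lborel (\<lambda>y. \<Sum>i\<in>A. ?c i * (?g a (t - y) * ?g i y))
     (\<Sum>i\<in>A. ?c i * (lam i / (lam i - lam a) * ?g a t + lam a / (lam a - lam i) * ?g i t))"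
    by (intro has_bochner_integral_sum has_bochner_integral_mult_right
        has_bochner_integral_mittag_leffler_convolution \<alpha> ne)
  moreover have "(\<lambda>y. \<Sum>i\<in>A. ?c i * (?g a (t - y) * ?g i y))
      = (\<lambda>y. ?g a (t - y) * mittag_leffler_mixture \<alpha> lam A y)"
    by (simp add: mittag_leffler_mixture_def sum_distrib_left mult_ac)
  moreover have "(\<Sum>i\<in>A. ?c i * (lam i / (lam i - lam a) * ?g a t + lam a / (lam a - lam i) * ?g i t))
      = mittag_leffler_mixture \<alpha> lam (insert a A) t"
  proof -
    have "(\<Sum>i\<in>A. ?c i * (lam i / (lam i - lam a))) = partial_fraction_coeff lam (insert a A) a"
      using A inj partial_fraction_decomposition[of A lam "lam a"]
      by (simp add: partial_fraction_coeff_insert_new)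
    then have "mittag_leffler_mixture \<alpha> lam (insert a A) t
      = (\<Sum>i\<in>A. ?c i * (lam i / (lam i - lam a))) * ?g a t
        + (\<Sum>i\<in>A. lam a / (lam a - lam i) * ?c i * ?g i t)"
      using A by (simp add: mittag_leffler_mixture_def partial_fraction_coeff_insert cong: sum.cong)
    then show ?thesis
      by (simp add: sum_distrib_left sum.distrib distrib_left mult_ac)
  qed
  ultimately show ?thesis by simp
qed

context prob_space
begin

text \<open>
  Nonnegativity of the mixture is carried along in the induction. It is invisible in the
  formula, whose weights differ in sign, but a convolution of nonnegative functions is
  nonnegative; it is also what allows the extended nonnegative convolution integral to be
  evaluated as a real one.
\<close>
lemma distributed_sum_mittag_leffler:
  assumes \<alpha>: "\<alpha> > 0" and A: "finite A" "A \<noteq> {}" and inj: "inj_on lam A"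
    and indep: "indep_vars (\<lambda>_. borel) X A"
    and tail: "\<And>i t. i \<in> A \<Longrightarrow> 0 \<le> t \<Longrightarrow>
           prob {\<omega> \<in> space M. X i \<omega> > t} = mittag_leffler \<alpha> (- lam i * t powr \<alpha>)"
  shows "distributed M lborel (\<lambda>\<omega>. \<Sum>i\<in>A. X i \<omega>) (\<lambda>t. ennreal (mittag_leffler_mixture \<alpha> lam A t))
       \<and> (\<forall>t. 0 \<le> mittag_leffler_mixture \<alpha> lam A t)"
  using A inj indep tail
proof (induction A rule: finite_ne_induct)
  case (singleton i)
  have "random_variable borel (X i)" using singleton.prems(2) by (auto simp: indep_vars_def)
  with singleton.prems(3) \<alpha> show ?case
    by (simp add: mittag_leffler_mixture_def partial_fraction_coeff_def
        distributed_mittag_leffler mittag_leffler_density_nonneg)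
next
  case (insert a A)
  let ?g = "mittag_leffler_density \<alpha> (lam a)" and ?f = "mittag_leffler_mixture \<alpha> lam A"
  have rv: "random_variable borel (X a)" using insert.prems(2) by (auto simp: indep_vars_def)
  have tail: "prob {\<omega> \<in> space M. X a \<omega> > t} = mittag_leffler \<alpha> (- lam a * t powr \<alpha>)" if "t \<ge> 0" for t
    using insert.prems(3) that by simp
  have IH: "distributed M lborel (\<lambda>\<omega>. \<Sum>i\<in>A. X i \<omega>) (\<lambda>t. ennreal (?f t))" "0 \<le> ?f t" for t
    using insert.IH insert.prems indep_vars_subset[OF insert.prems(2), of A] by auto
  have g: "0 \<le> ?g t" for t using mittag_leffler_density_nonneg[OF \<alpha> rv tail] .
  have conv: "has_bochner_integral lborel (\<lambda>y. ?g (t - y) * ?f y)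
           (mittag_leffler_mixture \<alpha> lam (insert a A) t)" for t
    using insert.hyps insert.prems(1) \<alpha> by (intro has_bochner_integral_mixture_convolution)
  have eq: "(\<integral>\<^sup>+y. ennreal (?g (t - y)) * ennreal (?f y) \<partial>lborel)
      = ennreal (mittag_leffler_mixture \<alpha> lam (insert a A) t)" for t
    using conv[of t] nn_integral_eq_integral[of lborel "\<lambda>y. ?g (t - y) * ?f y"] g IH(2)
    by (simp add: has_bochner_integral_iff ennreal_mult)
  have "distributed M lborel (\<lambda>\<omega>. X a \<omega> + (\<Sum>i\<in>A. X i \<omega>))
      (\<lambda>t. \<integral>\<^sup>+y. ennreal (?g (t - y)) * ennreal (?f y) \<partial>lborel)"
    using insert.hyps insert.prems(2)
    by (intro distributed_convolution indep_vars_sum distributed_mittag_leffler[OF \<alpha> rv tail] IH(1))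
  moreover have "0 \<le> mittag_leffler_mixture \<alpha> lam (insert a A) t" for t
  proof -
    have "0 \<le> (\<integral>y. ?g (t - y) * ?f y \<partial>lborel)"
      using g IH(2) by (intro Bochner_Integration.integral_nonneg mult_nonneg_nonneg)
    then show ?thesis using conv[of t] by (simp add: has_bochner_integral_iff)
  qed
  ultimately show ?case
    using insert.hyps by (simp add: eq)
qed

text \<open>
  Integrating the mixture over \<open>{..t}\<close> gives the same mixture of the distribution functions of
  the summands; as the coefficients sum to 1, this is 1 minus the mixture of the tails.
\<close>
lemma cdf_sum_mittag_leffler:
  assumes \<alpha>: "\<alpha> > 0" and A: "finite A" "A \<noteq> {}" and inj: "inj_on lam A"
    and pos: "\<And>i. i \<in> A \<Longrightarrow> 0 < lam i"
    and indep: "indep_vars (\<lambda>_. borel) X A"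
    and tail: "\<And>i t. i \<in> A \<Longrightarrow> 0 \<le> t \<Longrightarrow>
           prob {\<omega> \<in> space M. X i \<omega> > t} = mittag_leffler \<alpha> (- lam i * t powr \<alpha>)"
    and t: "t \<ge> 0"
  shows "cdf (distr M borel (\<lambda>\<omega>. \<Sum>i\<in>A. X i \<omega>)) t =
           1 - (\<Sum>i\<in>A. mittag_leffler \<alpha> (- lam i * t powr \<alpha>) * partial_fraction_coeff lam A i)"
proof -
  let ?S = "\<lambda>\<omega>. \<Sum>i\<in>A. X i \<omega>" and ?c = "partial_fraction_coeff lam A"
  have rv [measurable]: "random_variable borel (X i)" if "i \<in> A" for i
    using indep that by (auto simp: indep_vars_def)
  have S: "distributed M lborel ?S (\<lambda>t. ennreal (mittag_leffler_mixture \<alpha> lam A t))"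
    "0 \<le> mittag_leffler_mixture \<alpha> lam A u" for u
    using distributed_sum_mittag_leffler[OF \<alpha> A inj indep tail] by auto
  have 1: "has_bochner_integral lborel (\<lambda>u. mittag_leffler_mixture \<alpha> lam A u * indicator {..t} u)
      (prob {\<omega> \<in> space M. ?S \<omega> \<le> t})"
    using S \<alpha> by (intro has_bochner_integral_density_atMost) auto
  have Xi: "has_bochner_integral lborel (\<lambda>u. mittag_leffler_density \<alpha> (lam i) u * indicator {..t} u)
      (1 - mittag_leffler \<alpha> (- lam i * t powr \<alpha>))" if i: "i \<in> A" for i
  proof -
    have "prob {\<omega> \<in> space M. X i \<omega> \<le> t} = 1 - prob {\<omega> \<in> space M. X i \<omega> > t}"
      using rv[OF i] by (subst prob_compl[symmetric]) (auto intro!: arg_cong[of _ _ prob])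
    then show ?thesis
      using has_bochner_integral_density_atMost[OF distributed_mittag_leffler[OF \<alpha> rv[OF i] tail[OF i]], of t]
        mittag_leffler_density_nonneg[OF \<alpha> rv[OF i] tail[OF i]] tail[OF i t] \<alpha>
      by simp
  qed
  have "has_bochner_integral lborel
      (\<lambda>u. \<Sum>i\<in>A. ?c i * (mittag_leffler_density \<alpha> (lam i) u * indicator {..t} u))
      (\<Sum>i\<in>A. ?c i * (1 - mittag_leffler \<alpha> (- lam i * t powr \<alpha>)))"
    by (intro has_bochner_integral_sum has_bochner_integral_mult_right Xi)
  then have 2: "has_bochner_integral lborel (\<lambda>u. mittag_leffler_mixture \<alpha> lam A u * indicator {..t} u)
      (\<Sum>i\<in>A. ?c i * (1 - mittag_leffler \<alpha> (- lam i * t powr \<alpha>)))"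
    by (simp add: mittag_leffler_mixture_def sum_distrib_right mult.assoc)
  have "cdf (distr M borel ?S) t = prob {\<omega> \<in> space M. ?S \<omega> \<le> t}"
    unfolding cdf_def by (subst measure_distr) (auto intro!: arg_cong[of _ _ prob])
  also have "\<dots> = (\<Sum>i\<in>A. ?c i * (1 - mittag_leffler \<alpha> (- lam i * t powr \<alpha>)))"
    using 1 2 by (rule has_bochner_integral_eq)
  also have "\<dots> = 1 - (\<Sum>i\<in>A. mittag_leffler \<alpha> (- lam i * t powr \<alpha>) * ?c i)"
    using sum_partial_fraction_coeff[OF A inj pos]
    by (simp add: right_diff_distrib sum_subtractf mult.commute)
  finally show ?thesis .
qed

end

theorem proposition3p1:
  fixes M :: "'a measure" and X :: "nat \<Rightarrow> 'a \<Rightarrow> real"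
    and n :: nat and \<alpha> :: real and lam :: "nat \<Rightarrow> real"
  assumes "prob_space M"
    and "n \<ge> 1"
    and "0 < \<alpha>" and "\<alpha> \<le> 1"
    and "\<And>i. i \<in> {1..n} \<Longrightarrow> 0 < lam i"
    and "inj_on lam {1..n}"
    and "prob_space.indep_vars M (\<lambda>_. borel) X {1..n}"
    and "\<And>i t. i \<in> {1..n} \<Longrightarrow> 0 \<le> t \<Longrightarrow>
           measure M {\<omega> \<in> space M. X i \<omega> > t} = mittag_leffler \<alpha> (- lam i * t powr \<alpha>)"
  shows "has_pdf M (\<lambda>\<omega>. \<Sum>i=1..n. X i \<omega>)
           (\<lambda>t. if 0 < t then
                  t powr (\<alpha> - 1) *
                    (\<Sum>i=1..n. lam i * mittag_leffler2 \<alpha> \<alpha> (- lam i * t powr \<alpha>) *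
                       (\<Prod>k\<in>{1..n} - {i}. lam k / (lam k - lam i)))
                else 0)
       \<and> (\<forall>t\<ge>0. cdf (distr M borel (\<lambda>\<omega>. \<Sum>i=1..n. X i \<omega>)) t =
            1 - (\<Sum>i=1..n. mittag_leffler \<alpha> (- lam i * t powr \<alpha>) *
                   (\<Prod>k\<in>{1..n} - {i}. lam k / (lam k - lam i))))"
proof -
  interpret prob_space M by fact
  have A: "finite {1..n}" "{1..n} \<noteq> {}" using assms(2) by auto
  have pdf: "(\<lambda>t. if 0 < t then
                  t powr (\<alpha> - 1) *
                    (\<Sum>i=1..n. lam i * mittag_leffler2 \<alpha> \<alpha> (- lam i * t powr \<alpha>) *
                       (\<Prod>k\<in>{1..n} - {i}. lam k / (lam k - lam i)))
                else 0) = mittag_leffler_mixture \<alpha> lam {1..n}"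
    by (simp add: fun_eq_iff mittag_leffler_mixture_def mittag_leffler_density_def
        partial_fraction_coeff_def sum_distrib_left mult_ac)
  have "has_pdf M (\<lambda>\<omega>. \<Sum>i=1..n. X i \<omega>) (mittag_leffler_mixture \<alpha> lam {1..n})"
    using distributed_sum_mittag_leffler[OF assms(3) A assms(6,7,8)] assms(3)
    by (simp add: has_pdf_def)
  then show ?thesis
    unfolding pdf
    using cdf_sum_mittag_leffler[OF assms(3) A assms(6,5,7,8)]
    by (simp add: partial_fraction_coeff_def)
qed

end
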